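(* $R(12,12)\ge 1641$.
   Context: For positive integers $k,s$, the classical two-color Ramsey number $R(k,s)$ is the smallest integer $n$ such that every coloring of the edges of the complete graph $K_n$ with the two colors red and blue contains a red copy of $K_k$ (a set of $k$ vertices all of whose pairs are red) or a blue copy of $K_s$ (a set of $s$ vertices all of whose pairs are blue). *)

theory Defs
  imports "HOL-Library.Ramsey"
begin

text \<open>
  A colouring of the edges of the complete graph on \<open>{..<n}\<close> is a function from the
  2-element subsets of \<open>{..<n}\<close> to \<open>{0, 1}\<close>, with 0 for red and 1 for blue. Then
  \<open>partn_lst {..<n} [k, s] 2\<close> says that every such colouring has a red \<open>k\<close>-clique or a
  blue \<open>s\<close>-clique; see \<open>partn_lst_two_colours\<close> below.
\<close>

definition ramsey_number :: "nat \<Rightarrow> nat \<Rightarrow> nat" where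
  "ramsey_number k s = (LEAST n. partn_lst {..<n} [k, s] 2)"

lemma partn_lst_two_colours:
  fixes n :: nat
  shows "partn_lst {..<n} [k, s] 2 \<longleftrightarrow>
     (\<forall>f \<in> [{..<n}]\<^bsup>2\<^esup> \<rightarrow> {0, 1::nat}.
        (\<exists>H \<subseteq> {..<n}. card H = k \<and> (\<forall>e \<in> [H]\<^bsup>2\<^esup>. f e = 0)) \<or>
        (\<exists>H \<subseteq> {..<n}. card H = s \<and> (\<forall>e \<in> [H]\<^bsup>2\<^esup>. f e = 1)))"
proof -
  have colours: "{..<length [k, s]} = {0, 1}"
    by auto
  have "monochromatic {..<n} m 2 f i \<longleftrightarrow>
      (\<exists>H \<subseteq> {..<n}. card H = m \<and> (\<forall>e \<in> [H]\<^bsup>2\<^esup>. f e = i))" for m i and f :: "nat set \<Rightarrow> nat"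
    unfolding monochromatic_def nsets_def
    by (auto simp: image_subset_iff intro: finite_subset)
  then show ?thesis
    unfolding partn_lst_def colours by (simp add: less_Suc_eq ex_disj_distrib conj_disj_distribR disj_commute)
qed

text \<open>The minimum is attained, by Ramsey's theorem.\<close>

lemma ramsey_number_le_iff: "ramsey_number k s \<le> n \<longleftrightarrow> partn_lst {..<n} [k, s] 2"
proof
  have "partn_lst {..<ramsey_number k s} [k, s] 2"
    unfolding ramsey_number_def by (rule LeastI_ex) (rule ramsey_full)
  then show "partn_lst {..<n} [k, s] 2" if "ramsey_number k s \<le> n"
    using that by (rule partn_lst_greater_resource)
qed (simp add: ramsey_number_def Least_le)

end

theory Submission
  imports Defs "HOL-Number_Theory.Number_Theory"
begin

text \<open>
  The bound asks for a red-blue colouring of 1640 points without a monochromatic 12-clique. It is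
  found in three stages, and 1640 is \<open>2 * (797 + 1) + 44\<close>.

  The Paley graph on the integers modulo 797 has no 10-clique (\<open>paley_797_clique\<close>). This is a
  finite search, but a small one, because the affine maps \<open>x \<mapsto> u x + t\<close> with \<open>u\<close> a square act on
  the graph: every triangle of a clique can be moved to \<open>{0, 1, l}\<close>, and the six orderings of the
  triangle give the six ratios obtained from \<open>l\<close> under \<open>l \<mapsto> 1 - l\<close> and \<open>l \<mapsto> 1 / l\<close>. Only 33
  classes of ratios occur, and once a class is refuted all its members may be discarded.

  Add a point at infinity joined to everything, take two signed copies of every point, and colour
  a pair red when adjacency agrees with equality of signs. A map \<open>x \<mapsto> 1 / (x - a)\<close>, with suitable
  sign changes, moves any point to infinity, and a monochromatic clique through infinity is a
  clique of the Paley graph or of its complement, which is isomorphic to it. So cliques grow by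
  just one while the number of points doubles: 1596 points, no monochromatic 11-clique
  (\<open>doubled_797_clique\<close>).

  Finally 44 points are added at the cost of one more in the clique size. Let \<open>z\<close> be a point that
  lies on a red 10-clique \<open>z, x\<^sub>0, \<dots>, x\<^sub>8\<close> and on a blue 10-clique \<open>z, y\<^sub>0, \<dots>, y\<^sub>8\<close>. New are four
  further copies of \<open>z\<close>, a twin of each \<open>x\<^sub>i\<close> and of each \<open>y\<^sub>i\<close>, and eleven red and eleven blue
  hubs. The copies of \<open>z\<close>, the \<open>x\<^sub>i\<close>, their twins and the red hubs form the red side; replacing
  \<open>x\<^sub>i\<close> by \<open>y\<^sub>i\<close> and exchanging the colours gives the blue side. On the red side the blue pairs
  are the edges of a gadget graph on 34 vertices which is triangle-free and has only small
  independent sets that meet the hubs; on the blue side the red pairs form the same gadget. A red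
  hub is blue, and a blue hub red, to everything outside its own side and the opposite hubs. All
  remaining pairs are coloured like the points of the core that they copy.

  Consider a blue clique. If it has no blue hub, then it meets the red side in at most two points,
  as the gadget is triangle-free, and after deleting at most one of them it copies a blue clique
  of the core; so it has at most \<open>10 + 1\<close> points. If it has a blue hub, then apart from red hubs,
  of which there is at most one, it lies in the blue side and is independent in the gadget there.
  Such an independent set has at most 11 vertices, and at most 10 if its hubs have indices of one
  parity; as the colour of a pair of opposite hubs is given by the parity of the sum of the
  indices, the second bound applies whenever there is a red hub. Red cliques are treated in the
  same way, with the sides exchanged.
\<close>

section \<open>Colourings without monochromatic cliques\<close>

definition clique_of :: "('a \<Rightarrow> 'a \<Rightarrow> bool) \<Rightarrow> 'a set \<Rightarrow> bool" where
  "clique_of E S \<longleftrightarrow> (\<forall>u\<in>S. \<forall>v\<in>S. u \<noteq> v \<longrightarrow> E u v)"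

lemma clique_of_subset: "clique_of E S \<Longrightarrow> T \<subseteq> S \<Longrightarrow> clique_of E T"
  by (auto simp: clique_of_def)

lemma ramsey_number_greaterI:
  fixes col :: "'a \<Rightarrow> 'a \<Rightarrow> bool"
  assumes fin: "finite V" and sym: "\<And>u v. col u v = col v u"
    and red: "\<And>S. S \<subseteq> V \<Longrightarrow> clique_of (\<lambda>u v. col u v = True) S \<Longrightarrow> card S \<noteq> k"
    and blue: "\<And>S. S \<subseteq> V \<Longrightarrow> clique_of (\<lambda>u v. col u v = False) S \<Longrightarrow> card S \<noteq> l"
  shows "ramsey_number k l > card V"
proof (rule ccontr)
  assume "\<not> ramsey_number k l > card V"
  then have "partn_lst {..<card V} [k, l] 2" by (simp add: ramsey_number_le_iff[symmetric])
  moreover obtain b where b: "bij_betw b {..<card V} V"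
    using ex_bij_betw_nat_finite[OF fin] by (auto simp: lessThan_atLeast0)
  define f :: "nat set \<Rightarrow> nat" where
    "f e = (if \<exists>i j. i \<noteq> j \<and> e = {i, j} \<and> col (b i) (b j) then 0 else 1)" for e
  have f: "f {i, j} = (if col (b i) (b j) then 0 else 1)" if "i \<noteq> j" for i j
    using that sym by (auto simp: f_def doubleton_eq_iff)
  have "f \<in> [{..<card V}]\<^bsup>2\<^esup> \<rightarrow> {0, 1}" by (auto simp: f_def)
  ultimately obtain H where H: "H \<subseteq> {..<card V}"
    and mono: "card H = k \<and> (\<forall>e\<in>[H]\<^bsup>2\<^esup>. f e = 0) \<or> card H = l \<and> (\<forall>e\<in>[H]\<^bsup>2\<^esup>. f e = 1)"
    unfolding partn_lst_two_colours by blast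
  have inj: "inj_on b H" using b H inj_on_subset by (auto simp: bij_betw_def)
  have sub: "b ` H \<subseteq> V" using b H by (auto simp: bij_betw_def)
  have pair: "{i, j} \<in> [H]\<^bsup>2\<^esup>" if "i \<in> H" "j \<in> H" "i \<noteq> j" for i j
    using that by (auto simp: nsets_def)
  have "clique_of (\<lambda>u v. col u v = c) (b ` H)" if "\<forall>e\<in>[H]\<^bsup>2\<^esup>. f e = (if c then 0 else 1)" for c
  proof -
    have "col (b i) (b j) = c" if "i \<in> H" "j \<in> H" "b i \<noteq> b j" for i j
    proof -
      have "i \<noteq> j" using that by auto
      then have "f {i, j} = (if c then 0 else 1)" using pair that \<open>\<forall>e\<in>[H]\<^bsup>2\<^esup>. _\<close> by blast
      then show ?thesis using f[OF \<open>i \<noteq> j\<close>] by (cases c; cases "col (b i) (b j)") simp_all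
    qed
    then show ?thesis by (auto simp: clique_of_def)
  qed
  from this[of True] this[of False] show False
    using red[OF sub] blue[OF sub] mono by (auto simp: card_image[OF inj])
qed

section \<open>Clique search on adjacency rows\<close>

text \<open>
  A list of vertices is searched through the upper triangle of its adjacency matrix: the row of a
  vertex records its adjacency to the later vertices only. Passing to the later neighbours of a
  vertex then means deleting rows, and the corresponding entries of the remaining rows, according
  to the row of that vertex. No vertex names are left in this representation, so that a search
  step costs few rewrite steps and no arithmetic.
\<close>

fun entries :: "bool list \<Rightarrow> 'a list \<Rightarrow> 'a list" where
  "entries (True # bs) (x # xs) = x # entries bs xs"
| "entries (False # bs) (x # xs) = entries bs xs"
| "entries _ _ = []"

fun induced :: "bool list \<Rightarrow> bool list list \<Rightarrow> bool list list" where
  "induced (True # bs) (r # rs) = entries bs r # induced bs rs"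
| "induced (False # bs) (r # rs) = induced bs rs"
| "induced _ _ = []"

fun shorter :: "'a list \<Rightarrow> nat \<Rightarrow> bool" where
  "shorter _ 0 = False"
| "shorter [] (Suc n) = True"
| "shorter (x # xs) (Suc n) = shorter xs n"

text \<open>
  The conditionals, in contrast to propositional connectives, are evaluated lazily by the
  simplifier, so that a branch in which too few vertices are left is never entered.
\<close>

fun clique_free :: "nat \<Rightarrow> bool list list \<Rightarrow> bool" where
  "clique_free 0 rs = False"
| "clique_free (Suc k) [] = True"
| "clique_free (Suc k) (r # rs) =
     (if shorter rs k then True
      else if clique_free k (induced r rs) then clique_free (Suc k) rs else False)"

fun rows :: "('a \<Rightarrow> 'a \<Rightarrow> bool) \<Rightarrow> 'a list \<Rightarrow> bool list list" where
  "rows E [] = []"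
| "rows E (v # vs) = map (E v) vs # rows E vs"

lemma entries_map: "entries (map f xs) (map g xs) = map g (filter f xs)"
proof (induction xs)
  case (Cons x xs) then show ?case by (cases "f x") auto
qed auto

lemma induced_rows: "induced (map (E v) ws) (rows E ws) = rows E (filter (E v) ws)"
proof (induction ws)
  case (Cons w ws) then show ?case by (cases "E v w") (auto simp: entries_map)
qed auto

lemma length_rows [simp]: "length (rows E vs) = length vs"
  by (induction vs) auto

lemma shorter_iff: "shorter xs n \<longleftrightarrow> length xs < n"
  by (induction xs n rule: shorter.induct) auto

text \<open>
  A clique either contains the first vertex, and the rest of it lies among the later neighbours,
  or it avoids that vertex altogether.
\<close>

lemma clique_free_sound:
  assumes "clique_free k (rows E vs)" "S \<subseteq> set vs" "clique_of E S"
  shows "card S \<noteq> k"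
  using assms
proof (induction "length vs" arbitrary: vs k S rule: less_induct)
  case less
  show ?case
  proof (cases vs)
    case Nil
    then show ?thesis using less.prems by (cases k) auto
  next
    case (Cons v ws)
    obtain k' where k: "k = Suc k'" using less.prems(1) by (cases k) auto
    show ?thesis
    proof
      assume cardS: "card S = k"
      have fin: "finite S" using less.prems(2) finite_subset by blast
      have "card S \<le> length vs" using card_mono[OF _ less.prems(2)] card_length[of vs] by auto
      then have "\<not> length ws < k'" using cardS k Cons by (simp add: shorter_iff)
      then have c: "clique_free k' (rows E (filter (E v) ws))" "clique_free (Suc k') (rows E ws)"
        using less.prems(1) by (auto simp: Cons k induced_rows shorter_iff split: if_splits)
      show False
      proof (cases "v \<in> S")
        case True
        have "S - {v} \<subseteq> set (filter (E v) ws)"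
          using less.prems(2,3) True Cons by (auto simp: clique_of_def)
        moreover have "clique_of E (S - {v})" using less.prems(3) by (auto simp: clique_of_def)
        moreover have "length (filter (E v) ws) < length vs" using Cons by (simp add: less_Suc_eq_le)
        ultimately have "card (S - {v}) \<noteq> k'" using less.hyps c(1) by blast
        then show False using True cardS k fin by simp
      next
        case False
        then have "S \<subseteq> set ws" using less.prems(2) Cons by auto
        then show False using less.hyps[of ws k S] c(2) less.prems(3) cardS k Cons by auto
      qed
    qed
  qed
qed

text \<open>
  A search by blocks: a clique of \<open>Suc k\<close> vertices through the head of the first block is excluded
  within all vertices that are left, and then the whole block is discarded. Discarding the tail of
  the block along with its head has to be justified from outside, either because the tail is empty
  or by a symmetry. The vertices in \<open>rest\<close> are never tried as heads.
\<close>

fun sweep :: "('a \<Rightarrow> 'a \<Rightarrow> bool) \<Rightarrow> nat \<Rightarrow> 'a list list \<Rightarrow> 'a list \<Rightarrow> bool" where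
  "sweep E k [] rest = True"
| "sweep E k (B # Bs) rest =
     (clique_free k (rows E (filter (E (hd B)) (tl B @ concat Bs @ rest))) \<and> sweep E k Bs rest)"

lemma sweep_singletons_sound:
  assumes "sweep E k (map (\<lambda>h. [h]) hs) rest" "S \<subseteq> set hs \<union> set rest" "clique_of E S"
    "S \<inter> set hs \<noteq> {}"
  shows "card S \<noteq> Suc k"
  using assms
proof (induction hs)
  case (Cons h hs)
  have sw: "clique_free k (rows E (filter (E h) (hs @ rest)))" "sweep E k (map (\<lambda>h. [h]) hs) rest"
    using Cons.prems(1) by (auto simp: concat_map_singleton[of id, simplified])
  show ?case
  proof (cases "h \<in> S")
    case True
    have "S - {h} \<subseteq> set (filter (E h) (hs @ rest))"
      using Cons.prems(2,3) True by (auto simp: clique_of_def)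
    then have "card (S - {h}) \<noteq> k"
      using clique_free_sound[OF sw(1)] clique_of_subset[OF Cons.prems(3), of "S - {h}"] by auto
    then show ?thesis using True by (auto simp: card_Suc_Diff1 card_gt_0_iff dest: card_ge_0_finite)
  next
    case False
    then show ?thesis using Cons.IH[OF sw(2) _ Cons.prems(3)] Cons.prems(2,4) by auto
  qed
qed simp

lemmas search_simps = clique_free.simps induced.simps entries.simps shorter.simps
  eval_nat_numeral BitM.simps if_True if_False simp_thms

section \<open>Quadratic residues\<close>

lemma Legendre_values: "Legendre a m \<in> {-1, 0, 1}"
  by (simp add: Legendre_def)

lemma Legendre_cong:
  assumes "[a = b] (mod m)" shows "Legendre a m = Legendre b m"
proof -
  have "[a = 0] (mod m) \<longleftrightarrow> [b = 0] (mod m)" using assms cong_sym cong_trans by blast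
  moreover have "QuadRes m a \<longleftrightarrow> QuadRes m b" unfolding QuadRes_def using assms cong_sym cong_trans by blast
  ultimately show ?thesis by (simp add: Legendre_def)
qed

lemma Legendre_eq_0_iff: "Legendre a m = 0 \<longleftrightarrow> m dvd a"
  by (simp add: Legendre_def cong_0_iff)

context
  fixes p :: nat
  assumes p: "prime p" "2 < p"
begin

lemma Legendre_eqI:
  assumes "[Legendre a p = x] (mod int p)" "x \<in> {-1, 0, 1}"
  shows "Legendre a p = x"
proof -
  have "int p dvd Legendre a p - x" using assms(1) by (simp add: cong_iff_dvd_diff)
  moreover have "\<bar>Legendre a p - x\<bar> \<le> 2" using Legendre_values[of a "int p"] assms(2) by auto
  ultimately show ?thesis using p(2) zdvd_not_zless[of "\<bar>Legendre a p - x\<bar>" "int p"] by auto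
qed

text \<open>
  By Euler's criterion the symbol is a power modulo \<open>p\<close>, and powers are multiplicative; two values
  in \<open>{-1, 0, 1}\<close> that agree modulo \<open>p > 2\<close> are equal.
\<close>

lemma Legendre_mult: "Legendre (a * b) p = Legendre a p * Legendre b p"
proof (rule Legendre_eqI)
  have "[Legendre (a * b) p = (a * b) ^ ((p - 1) div 2)] (mod int p)" by (rule euler_criterion[OF p])
  moreover have "[Legendre a p * Legendre b p = (a * b) ^ ((p - 1) div 2)] (mod int p)"
    unfolding power_mult_distrib by (intro cong_mult euler_criterion[OF p])
  ultimately show "[Legendre (a * b) p = Legendre a p * Legendre b p] (mod int p)"
    using cong_sym cong_trans by blast
qed (use Legendre_values[of a "int p"] Legendre_values[of b "int p"] in auto)

lemma Legendre_minus:
  assumes "[p = 1] (mod 4)" shows "Legendre (- a) p = Legendre a p"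
proof -
  have "even ((p - 1) div 2)" using assms p(2) unfolding cong_def by presburger
  then have "[Legendre (- 1) p = 1] (mod int p)" using euler_criterion[OF p, of "-1"] by simp
  then have "Legendre (- 1) p = 1" by (rule Legendre_eqI) simp
  then show ?thesis using Legendre_mult[of "-1" a] by simp
qed

lemma Legendre_square: "\<not> int p dvd a \<Longrightarrow> Legendre (a * a) p = 1"
  using Legendre_values[of a "int p"] Legendre_eq_0_iff[of a "int p"] by (auto simp: Legendre_mult)

lemma inverse_mod_ex: "\<not> int p dvd a \<Longrightarrow> \<exists>u. [a * u = 1] (mod int p)"
  using p(1) by (intro cong_solve_coprime_int)
    (metis coprime_commute prime_imp_coprime_int prime_int_nat_transfer prime_nat_int_transfer)
end

section \<open>Cliques of Paley graphs and their ratios\<close>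

text \<open>
  The congruence modulo 4 makes -1 a square, and hence adjacency symmetric.
\<close>

locale paley_prime =
  fixes p :: nat
  assumes prime_p: "prime p" and p_mod_4: "[p = 1] (mod 4)"
begin

lemma p_gt_2: "2 < p"
proof -
  have "p \<noteq> 0" "p \<noteq> 1" "p \<noteq> 2" using prime_p p_mod_4 by (auto simp: cong_def)
  then show ?thesis by linarith
qed

lemmas mult = Legendre_mult[OF prime_p p_gt_2]
  and minus = Legendre_minus[OF prime_p p_gt_2 p_mod_4]

definition paley :: "int \<Rightarrow> int \<Rightarrow> bool" where
  "paley u v \<longleftrightarrow> Legendre (u - v) p = 1"

lemma Legendre_minus_commute: "Legendre (u - v) p = Legendre (v - u) p"
  using minus[of "u - v"] by simp

lemma paley_sym: "paley u v = paley v u"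
  unfolding paley_def by (subst Legendre_minus_commute) rule

lemma paley_not_dvd: "paley u v \<Longrightarrow> \<not> int p dvd u - v"
  using Legendre_eq_0_iff[of "u - v" "int p"] by (auto simp: paley_def)

text \<open>
  The ratio of an ordered triple \<open>(x, y, w)\<close> is \<open>(w - x) / (y - x)\<close>, the image of \<open>w\<close> under the
  affine map that sends \<open>x\<close> to 0 and \<open>y\<close> to 1. Reordering a triple turns its ratio \<open>l\<close> into
  \<open>1 - l\<close> or \<open>1 / l\<close>, so the ratios of a set are closed under both operations.
\<close>

definition ratios :: "int set \<Rightarrow> int set" where
  "ratios Q = {l. \<exists>x\<in>Q. \<exists>y\<in>Q. \<exists>w\<in>Q. x \<noteq> y \<and> x \<noteq> w \<and> y \<noteq> w \<and> [w - x = l * (y - x)] (mod int p)}"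

lemma ratiosI:
  assumes "x \<in> Q" "y \<in> Q" "w \<in> Q" "x \<noteq> y" "x \<noteq> w" "y \<noteq> w" "[w - x = l * (y - x)] (mod int p)"
  shows "l \<in> ratios Q"
  using assms by (auto simp: ratios_def)

lemma ratiosE:
  assumes "l \<in> ratios Q"
  obtains x y w where "x \<in> Q" "y \<in> Q" "w \<in> Q" "x \<noteq> y" "x \<noteq> w" "y \<noteq> w" "[w - x = l * (y - x)] (mod int p)"
  using assms by (auto simp: ratios_def)

lemma ratios_cong: "[l = m] (mod int p) \<Longrightarrow> l \<in> ratios Q \<Longrightarrow> m \<in> ratios Q"
  by (elim ratiosE) (rule ratiosI, assumption+, erule cong_trans, erule cong_scalar_right)

lemma ratios_one_minus:
  assumes "l \<in> ratios Q" "[l + m = 1] (mod int p)" shows "m \<in> ratios Q"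
proof -
  obtain x y w where xyw: "x \<in> Q" "y \<in> Q" "w \<in> Q" "x \<noteq> y" "x \<noteq> w" "y \<noteq> w"
    and c: "[w - x = l * (y - x)] (mod int p)" using assms(1) by (rule ratiosE)
  have "int p dvd (w - x) - l * (y - x)" "int p dvd l + m - 1"
    using c assms(2) by (simp_all add: cong_iff_dvd_diff)
  then have "int p dvd ((w - x) - l * (y - x)) + (l + m - 1) * (y - x)" by (intro dvd_add dvd_mult2)
  also have "((w - x) - l * (y - x)) + (l + m - 1) * (y - x) = (w - y) - m * (x - y)" by (simp add: algebra_simps)
  finally have "[w - y = m * (x - y)] (mod int p)" by (simp add: cong_iff_dvd_diff)
  then show ?thesis by (rule ratiosI[OF xyw(2,1,3) xyw(4)[symmetric] xyw(6,5)])
qed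

lemma ratios_inverse:
  assumes "l \<in> ratios Q" "[l * m = 1] (mod int p)" shows "m \<in> ratios Q"
proof -
  obtain x y w where xyw: "x \<in> Q" "y \<in> Q" "w \<in> Q" "x \<noteq> y" "x \<noteq> w" "y \<noteq> w"
    and c: "[w - x = l * (y - x)] (mod int p)" using assms(1) by (rule ratiosE)
  have "int p dvd (w - x) - l * (y - x)" "int p dvd l * m - 1"
    using c assms(2) by (simp_all add: cong_iff_dvd_diff)
  then have "int p dvd ((w - x) - l * (y - x)) * (- m) + (l * m - 1) * (- (y - x))" by (intro dvd_add dvd_mult2)
  also have "((w - x) - l * (y - x)) * (- m) + (l * m - 1) * (- (y - x)) = (y - x) - m * (w - x)" by (simp add: algebra_simps)
  finally have "[y - x = m * (w - x)] (mod int p)" by (simp add: cong_iff_dvd_diff)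
  then show ?thesis by (rule ratiosI[OF xyw(1,3,2,5,4) xyw(6)[symmetric]])
qed

text \<open>
  If \<open>l\<close> is the ratio of \<open>(x, y, w)\<close>, then \<open>v \<mapsto> (v - x) / (y - x)\<close> moves the clique to one that
  contains \<open>0, 1, l\<close>. The map preserves adjacency because \<open>y - x\<close> is a square, and it preserves
  all ratios.
\<close>

lemma normalise:
  assumes Q: "clique_of paley Q" and l: "l \<in> ratios Q"
  obtains Q' where "clique_of paley Q'" "card Q' = card Q" "ratios Q' \<subseteq> ratios Q"
    "Q' \<subseteq> {0..<int p}" "{0, 1, l mod int p} \<subseteq> Q'" "l mod int p \<notin> {0, 1}"
proof -
  obtain x y w where xyw: "x \<in> Q" "y \<in> Q" "w \<in> Q" "x \<noteq> y" "x \<noteq> w" "y \<noteq> w"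
    and c: "[w - x = l * (y - x)] (mod int p)" using l by (rule ratiosE)
  have yx: "Legendre (y - x) p = 1" using Q xyw by (auto simp: clique_of_def paley_def)
  then obtain u where u: "[(y - x) * u = 1] (mod int p)"
    using inverse_mod_ex[OF prime_p p_gt_2, of "y - x"] Legendre_eq_0_iff[of "y - x" "int p"] by auto
  have "Legendre ((y - x) * u) p = Legendre (1 * 1) p" using Legendre_cong[OF u] by simp
  also have "\<dots> = 1" using p_gt_2 by (intro Legendre_square[OF prime_p p_gt_2]) auto
  finally have Lu: "Legendre u p = 1" by (simp add: mult yx)
  define f where "f v = (u * (v - x)) mod int p" for v
  have f: "[f a - f b = u * (a - b)] (mod int p)" for a b
    unfolding f_def cong_def by (simp add: mod_diff_eq algebra_simps)
  have Lf: "Legendre (f a - f b) p = Legendre (a - b) p" for a b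
    using Legendre_cong[OF f[of a b]] by (simp add: mult Lu)
  have inj: "f a \<noteq> f b" if "a \<in> Q" "b \<in> Q" "a \<noteq> b" for a b
  proof
    assume "f a = f b"
    then have "Legendre 0 p = Legendre (a - b) p" using Lf[of a b] by simp
    then show False using Q that by (auto simp: clique_of_def paley_def Legendre_eq_0_iff[THEN iffD2])
  qed
  have "p > 1" using p_gt_2 by simp
  have "f y = 1" using u \<open>p > 1\<close> by (simp add: f_def cong_def mult.commute)
  have "[u * (w - x) = u * (l * (y - x))] (mod int p)" by (rule cong_scalar_left[OF c])
  also have "u * (l * (y - x)) = l * ((y - x) * u)" by simp
  also have "[\<dots> = l * 1] (mod int p)" by (rule cong_scalar_left[OF u])
  finally have "f w = l mod int p" by (simp add: f_def cong_def)
  show ?thesis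
  proof
    show "clique_of paley (f ` Q)" using Q by (auto simp: clique_of_def paley_def Lf)
    show "card (f ` Q) = card Q" using inj by (intro card_image inj_onI) blast
    show "f ` Q \<subseteq> {0..<int p}" using \<open>p > 1\<close> by (auto simp: f_def)
    have "f x = 0" by (simp add: f_def)
    then show "{0, 1, l mod int p} \<subseteq> f ` Q" "l mod int p \<notin> {0, 1}"
      using xyw \<open>f y = 1\<close> \<open>f w = l mod int p\<close> inj[of x w] inj[of y w] by (auto simp: image_iff) metis+
    show "ratios (f ` Q) \<subseteq> ratios Q"
    proof
      fix m assume "m \<in> ratios (f ` Q)"
      then obtain a b d where abd: "a \<in> Q" "b \<in> Q" "d \<in> Q" "f a \<noteq> f b" "f a \<noteq> f d" "f b \<noteq> f d"
        and m: "[f d - f a = m * (f b - f a)] (mod int p)" by (auto simp: ratios_def)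
      have "[(y - x) * u * (d - a) = (y - x) * (f d - f a)] (mod int p)"
        using cong_scalar_left[OF f[of d a], of "y - x"] by (simp add: cong_sym_eq mult.assoc)
      also have "[(y - x) * (f d - f a) = (y - x) * (m * (f b - f a))] (mod int p)"
        by (rule cong_scalar_left[OF m])
      also have "[(y - x) * (m * (f b - f a)) = (y - x) * (m * (u * (b - a)))] (mod int p)"
        by (intro cong_scalar_left f)
      also have "(y - x) * (m * (u * (b - a))) = (y - x) * u * (m * (b - a))" by simp
      finally have "[(y - x) * u * (d - a) = (y - x) * u * (m * (b - a))] (mod int p)" .
      moreover have "[(y - x) * u * v = v] (mod int p)" for v
        using cong_scalar_right[OF u, of v] by simp
      ultimately have "[d - a = m * (b - a)] (mod int p)" using cong_sym cong_trans by meson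
      then show "m \<in> ratios Q" using abd by (intro ratiosI[of a Q b d]) auto
    qed
  qed
qed

text \<open>
  For a head \<open>a\<close> the list is \<open>a, 1 - a, 1 / a, 1 - 1 / a, 1 / (1 - a), 1 - 1 / (1 - a)\<close> modulo
  \<open>p\<close>.
\<close>

definition orbit :: "int list \<Rightarrow> bool" where
  "orbit B \<longleftrightarrow> (\<exists>a b c d e f. B = [a, b, c, d, e, f] \<and> [b + a = 1] (mod int p) \<and> [c * a = 1] (mod int p)
     \<and> [d + c = 1] (mod int p) \<and> [e * b = 1] (mod int p) \<and> [f + e = 1] (mod int p))"

lemma orbit_ratios:
  assumes "orbit B" "l \<in> set B" "l \<in> ratios Q" shows "hd B \<in> ratios Q"
proof -
  obtain a b c d e f where B: "B = [a, b, c, d, e, f]"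
    and o: "[b + a = 1] (mod int p)" "[c * a = 1] (mod int p)" "[d + c = 1] (mod int p)"
      "[e * b = 1] (mod int p)" "[f + e = 1] (mod int p)"
    using assms(1) by (auto simp: orbit_def)
  have "b \<in> ratios Q \<Longrightarrow> a \<in> ratios Q" "c \<in> ratios Q \<Longrightarrow> a \<in> ratios Q"
    "d \<in> ratios Q \<Longrightarrow> c \<in> ratios Q" "e \<in> ratios Q \<Longrightarrow> b \<in> ratios Q"
    "f \<in> ratios Q \<Longrightarrow> e \<in> ratios Q"
    using ratios_one_minus[OF _ o(1)] ratios_inverse[OF _ o(2)] ratios_one_minus[OF _ o(3)]
      ratios_inverse[OF _ o(4)] ratios_one_minus[OF _ o(5)] by blast+
  then show ?thesis using assms(2,3) B by auto
qed

text \<open>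
  A normalised clique contains 0, 1 and some ratio \<open>l\<close>, and all its other vertices are ratios as
  well, since \<open>v\<close> is the ratio of \<open>(0, 1, v)\<close>. Hence the search runs over ratios only. If the head
  of the first orbit is a ratio of \<open>Q\<close>, then \<open>Q\<close> can be normalised so as to contain it, and the
  search applies; if it is not, then no member of the orbit is a ratio of \<open>Q\<close>, and the orbit may
  be discarded.
\<close>

lemma sweep_orbits_sound:
  assumes "sweep paley k Bs []" "\<forall>B\<in>set Bs. orbit B \<and> set B \<subseteq> {0..<int p}"
    and "clique_of paley Q" "3 \<le> card Q"
    and "\<And>l. l \<in> ratios Q \<Longrightarrow> l \<in> {0..<int p} \<Longrightarrow> paley l 0 \<Longrightarrow> paley l 1 \<Longrightarrow> l \<in> set (concat Bs)"
  shows "card Q \<noteq> k + 3"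
  using assms(1,2,5)
proof (induction Bs)
  case Nil
  obtain T where "T \<subseteq> Q" "card T = 3" using obtain_subset_with_card_n[OF assms(4)] by metis
  then obtain x y w where xyw: "x \<in> Q" "y \<in> Q" "w \<in> Q" "x \<noteq> y" "x \<noteq> w" "y \<noteq> w"
    by (auto simp: card_3_iff)
  have "paley y x" using assms(3) xyw by (auto simp: clique_of_def)
  then obtain u where u: "[(y - x) * u = 1] (mod int p)"
    using inverse_mod_ex[OF prime_p p_gt_2] paley_not_dvd by blast
  have "[w - x = (w - x) * u * (y - x)] (mod int p)"
    using cong_scalar_left[OF u, of "w - x"] by (simp add: cong_sym_eq mult_ac)
  then have "(w - x) * u \<in> ratios Q" by (rule ratiosI[OF xyw])
  then have l: "(w - x) * u mod int p \<in> ratios Q" by (rule ratios_cong[rotated]) simp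
  obtain Q' where Q': "clique_of paley Q'" "Q' \<subseteq> {0..<int p}"
    "{0, 1, (w - x) * u mod int p mod int p} \<subseteq> Q'" "(w - x) * u mod int p mod int p \<notin> {0, 1}"
    using normalise[OF assms(3) l] by metis
  then have "paley ((w - x) * u mod int p) 0" "paley ((w - x) * u mod int p) 1"
    by (auto simp: clique_of_def)
  then show ?case using Nil(3)[OF l] Q'(2,3) by auto
next
  case (Cons B Bs)
  have sw: "clique_free k (rows paley (filter (paley (hd B)) (tl B @ concat Bs)))" "sweep paley k Bs []"
    using Cons.prems(1) by auto
  have B: "orbit B" "set B \<subseteq> {0..<int p}" using Cons.prems(2) by auto
  have hd: "hd B \<in> set B" using B(1) by (auto simp: orbit_def)
  then have c: "hd B mod int p = hd B" using B(2) by auto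
  show ?case
  proof (cases "hd B \<in> ratios Q")
    case True
    obtain Q' where Q': "clique_of paley Q'" "card Q' = card Q" "ratios Q' \<subseteq> ratios Q"
      "Q' \<subseteq> {0..<int p}" "{0, 1, hd B} \<subseteq> Q'" "hd B \<notin> {0, 1}"
      using normalise[OF assms(3) True] unfolding c by metis
    have "v \<in> set (filter (paley (hd B)) (tl B @ concat Bs))" if v: "v \<in> Q' - {0, 1, hd B}" for v
    proof -
      have "v \<in> ratios Q'"
        using Q'(5) v by (intro ratiosI[of 0 Q' 1 v]) auto
      moreover have "paley v 0" "paley v 1" "v \<in> {0..<int p}"
        using Q'(1,4,5) v by (auto simp: clique_of_def)
      ultimately have "v \<in> set (concat (B # Bs))"
        using Cons.prems(3) Q'(3) by blast
      moreover have "B = hd B # tl B" using B(1) by (auto simp: orbit_def)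
      ultimately have "v \<in> set (tl B @ concat Bs)" using v
        by (metis DiffD2 Un_iff concat.simps(2) insertCI set_ConsD set_append append_Cons)
      moreover have "paley (hd B) v" using Q' v by (auto simp: clique_of_def)
      ultimately show ?thesis by simp
    qed
    then have "card (Q' - {0, 1, hd B}) \<noteq> k"
      using clique_free_sound[OF sw(1)] clique_of_subset[OF Q'(1), of "Q' - {0, 1, hd B}"] by blast
    moreover have "card (Q' - {0, 1, hd B}) = card Q' - 3"
      using Q'(5,6) by (subst card_Diff_subset) auto
    ultimately show ?thesis using Q'(2) by simp
  next
    case False
    have "l \<in> set (concat Bs)"
      if l: "l \<in> ratios Q" "l \<in> {0..<int p}" "paley l 0" "paley l 1" for l
      using Cons.prems(3)[OF l] orbit_ratios[OF B(1) _ l(1)] False by auto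
    then show ?thesis using Cons.IH[OF sw(2)] Cons.prems(2) by simp
  qed
qed

subsection \<open>Doubling a Paley graph\<close>

lemma Legendre_not_dvd: "\<not> int p dvd a \<Longrightarrow> Legendre a p = (if Legendre a p = 1 then 1 else -1)"
  using Legendre_values[of a "int p"] Legendre_eq_0_iff[of a "int p"] by auto

lemma not_dvd_diff: "x \<in> {0..<int p} \<Longrightarrow> y \<in> {0..<int p} \<Longrightarrow> x \<noteq> y \<Longrightarrow> \<not> int p dvd x - y"
  by (simp add: mod_eq_dvd_iff[symmetric])

text \<open>
  Here \<open>None\<close> is the point at infinity. The two copies of a point form a red pair, which lies in
  no monochromatic triangle: a third point sees the two copies in different colours.
\<close>

definition extended :: "int option \<Rightarrow> int option \<Rightarrow> bool" where
  "extended u v = (case (u, v) of (Some x, Some y) \<Rightarrow> paley x y | _ \<Rightarrow> True)"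

definition doubled :: "int option \<times> bool \<Rightarrow> int option \<times> bool \<Rightarrow> bool" where
  "doubled u v \<longleftrightarrow> fst u = fst v \<or> extended (fst u) (fst v) = (snd u = snd v)"

definition double_points :: "(int option \<times> bool) set" where
  "double_points = insert None (Some ` {0..<int p}) \<times> UNIV"

lemma doubled_sym: "doubled u v = doubled v u"
  by (auto simp: doubled_def extended_def paley_sym split: option.splits)

lemma card_double_points: "finite double_points" "card double_points = 2 * (p + 1)"
  by (auto simp: double_points_def card_cartesian_product card_image)

text \<open>
  Multiplication by a non-residue exchanges squares and non-squares.
\<close>

lemma paley_self_complementary:
  assumes clique: "\<And>S. S \<subseteq> {0..<int p} \<Longrightarrow> clique_of paley S \<Longrightarrow> card S \<noteq> k"
    and n: "Legendre n p = -1"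
    and S: "S \<subseteq> {0..<int p}" "clique_of (\<lambda>u v. paley u v = s) S"
  shows "card S \<noteq> k"
proof (cases s)
  case False
  define f where "f v = n * v mod int p" for v
  have f: "[f a - f b = n * (a - b)] (mod int p)" for a b
    unfolding f_def cong_def by (simp add: mod_diff_eq algebra_simps)
  have pf: "paley (f a) (f b)" if "a \<in> S" "b \<in> S" "a \<noteq> b" for a b
  proof -
    have "\<not> paley a b" using S(2) that False by (auto simp: clique_of_def)
    moreover have "a \<in> {0..<int p}" "b \<in> {0..<int p}" using that S(1) by auto
    ultimately have "Legendre (a - b) p = -1"
      using Legendre_not_dvd[OF not_dvd_diff[OF _ _ that(3)]] by (simp add: paley_def split: if_splits)
    then show ?thesis using Legendre_cong[OF f[of a b]] by (simp add: paley_def mult n)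
  qed
  have "inj_on f S" using pf paley_not_dvd by (fastforce intro!: inj_onI)
  moreover have "f ` S \<subseteq> {0..<int p}" using p_gt_2 by (auto simp: f_def)
  moreover have "clique_of paley (f ` S)" using pf by (auto simp: clique_of_def)
  ultimately show ?thesis using clique[of "f ` S"] by (simp add: card_image)
qed (use S clique in auto)

text \<open>
  In a monochromatic clique through \<open>(None, e)\<close> all other points have the same sign, and so their
  adjacency is constant. A clique that avoids infinity is brought into this form by
  \<open>x \<mapsto> 1 / (x - a)\<close> for one of its points \<open>(Some a, e)\<close>: as
  \<open>1 / (x - a) - 1 / (y - a) = (y - x) / ((x - a) * (y - a))\<close>, the symbols of \<open>x - a\<close> and \<open>y - a\<close>
  make up exactly for the signs.
\<close>

lemma doubled_clique:
  assumes field: "\<And>s S. S \<subseteq> {0..<int p} \<Longrightarrow> clique_of (\<lambda>u v. paley u v = s) S \<Longrightarrow> card S \<noteq> k"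
    and Q: "Q \<subseteq> double_points" "clique_of (\<lambda>u v. doubled u v = s) Q" and k: "2 \<le> k"
  shows "card Q \<noteq> Suc k"
proof
  assume card: "card Q = Suc k"
  then have fin: "finite Q" using card.infinite by fastforce
  have Qd: "doubled u v = s" if "u \<in> Q" "v \<in> Q" "u \<noteq> v" for u v
    using that Q(2) by (auto simp: clique_of_def)
  have inj: "fst u \<noteq> fst v" if uv: "u \<in> Q" "v \<in> Q" "u \<noteq> v" for u v
  proof
    assume eq: "fst u = fst v"
    \<comment> \<open>A third point of the clique would see the two copies in different colours.\<close>
    have "\<not> Q \<subseteq> {u, v}" using card_mono[of "{u, v}" Q] card k uv(3) by auto
    then obtain w where w: "w \<in> Q" "w \<noteq> u" "w \<noteq> v" by blast
    have "snd u \<noteq> snd v" using eq uv(3) by (auto simp: prod_eq_iff)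
    moreover have "fst w \<noteq> fst u"
    proof
      assume "fst w = fst u"
      then have "snd w = snd u \<or> snd w = snd v" using \<open>snd u \<noteq> snd v\<close> by auto
      then show False using w eq \<open>fst w = fst u\<close> by (auto simp: prod_eq_iff)
    qed
    ultimately have "doubled w u \<noteq> doubled w v" using eq by (auto simp: doubled_def)
    then show False using Qd w uv by metis
  qed
  have "Q \<noteq> {}" using card by auto
  show False
  proof (cases "\<exists>e. (None, e) \<in> Q")
    case True
    then obtain e where e: "(None, e) \<in> Q" by blast
    define f where "f u = the (fst u)" for u :: "int option \<times> bool"
    have Some: "fst u = Some (f u)" "f u \<in> {0..<int p}" "(snd u = e) = s" if "u \<in> Q - {(None, e)}" for u
      using inj[of u "(None, e)"] Qd[of u "(None, e)"] that e Q(1)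
      by (auto simp: f_def double_points_def doubled_def extended_def)
    have pf: "f u \<noteq> f v \<and> paley (f u) (f v) = s" if "u \<in> Q - {(None, e)}" "v \<in> Q - {(None, e)}" "u \<noteq> v" for u v
      using Some[OF that(1)] Some[OF that(2)] inj[of u v] Qd[of u v] that
      by (auto simp: doubled_def extended_def)
    let ?S = "f ` (Q - {(None, e)})"
    have "card ?S = k" using pf card e fin by (subst card_image) (auto intro!: inj_onI)
    moreover have "?S \<subseteq> {0..<int p}" using Some(2) by (rule image_subsetI)
    moreover have "clique_of (\<lambda>u v. paley u v = s) ?S" using pf by (auto simp: clique_of_def)
    ultimately show False using field by blast
  next
    case False
    then obtain a e where ae: "(Some a, e) \<in> Q" using \<open>Q \<noteq> {}\<close> by (metis ex_in_conv option.exhaust surj_pair)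
    obtain g where g: "\<And>x. \<not> int p dvd x \<Longrightarrow> [x * g x = 1] (mod int p)"
      using inverse_mod_ex[OF prime_p p_gt_2] by metis
    define f where "f u = g (the (fst u) - a) mod int p" for u :: "int option \<times> bool"
    have pf: "f u \<noteq> f v \<and> paley (f u) (f v) = s"
      if uv: "u \<in> Q - {(Some a, e)}" "v \<in> Q - {(Some a, e)}" "u \<noteq> v" for u v
    proof -
      obtain x d y d' where u: "u = (Some x, d)" and v: "v = (Some y, d')"
        using uv False by (metis DiffD1 option.exhaust surj_pair)
      have dist: "x \<noteq> a" "y \<noteq> a" "x \<noteq> y" using inj[of u "(Some a, e)"] inj[of v "(Some a, e)"] inj[of u v] uv ae u v by auto
      have range: "x \<in> {0..<int p}" "y \<in> {0..<int p}" "a \<in> {0..<int p}" using Q(1) uv ae u v by (auto simp: double_points_def)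
      note nd = not_dvd_diff[OF range(1,3) dist(1)] not_dvd_diff[OF range(2,3) dist(2)] not_dvd_diff[OF range(1,2) dist(3)]
      have col: "paley x a = ((d = e) = s)" "paley y a = ((d' = e) = s)" "paley x y = ((d = d') = s)"
        using Qd[of u "(Some a, e)"] Qd[of v "(Some a, e)"] Qd[of u v] uv ae dist u v
        by (auto simp: doubled_def extended_def)
      have L: "Legendre (x - a) p = (if (d = e) = s then 1 else -1)" "Legendre (y - a) p = (if (d' = e) = s then 1 else -1)"
        "Legendre (x - y) p = (if (d = d') = s then 1 else -1)"
        using nd[THEN Legendre_not_dvd] col by (simp_all add: paley_def)
      have "int p dvd (x - a) * g (x - a) - 1" "int p dvd (y - a) * g (y - a) - 1"
        using g nd by (simp_all add: cong_iff_dvd_diff)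
      then have "int p dvd ((x - a) * g (x - a) - 1) * (y - a) + ((y - a) * g (y - a) - 1) * (- (x - a))"
        by (intro dvd_add dvd_mult2)
      also have "\<dots> = (x - a) * (y - a) * (g (x - a) - g (y - a)) - (y - x)" by (simp add: algebra_simps)
      finally have "[y - x = (x - a) * (y - a) * (g (x - a) - g (y - a))] (mod int p)"
        unfolding cong_iff_dvd_diff by (subst dvd_diff_commute)
      moreover have "[(x - a) * (y - a) * (g (x - a) - g (y - a)) = (x - a) * (y - a) * (f u - f v)] (mod int p)"
        unfolding f_def u v by (intro cong_mult cong_diff) (auto simp: cong_def)
      ultimately have "Legendre (y - x) p = Legendre ((x - a) * (y - a) * (f u - f v)) p"
        by (intro Legendre_cong) (rule cong_trans)
      then have "Legendre (x - y) p = Legendre (x - a) p * Legendre (y - a) p * Legendre (f u - f v) p"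
        by (simp add: mult Legendre_minus_commute[of y x])
      then have "Legendre (f u - f v) p = (if s then 1 else -1)"
        unfolding L by (auto split: if_splits)
      then show ?thesis by (auto simp: paley_def Legendre_eq_0_iff[THEN iffD2] split: if_splits)
    qed
    let ?S = "f ` (Q - {(Some a, e)})"
    have "card ?S = k" using pf card ae fin by (subst card_image) (auto intro!: inj_onI)
    moreover have "?S \<subseteq> {0..<int p}" using p_gt_2 by (auto simp: f_def)
    moreover have "clique_of (\<lambda>u v. paley u v = s) ?S" using pf by (auto simp: clique_of_def)
    ultimately show False using field by blast
  qed
qed

end

section \<open>The Paley graph on 797 points\<close>

lemma prime_797: "prime (797::nat)"
proof (rule ccontr)
  assume "\<not> prime (797::nat)"
  then obtain n :: nat where "n \<in> {2..<797}" "n dvd 797" unfolding prime_nat_iff' by auto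
  then obtain m where n: "2 \<le> n" "n < 797" "797 = n * m" by (auto elim: dvdE)
  then have "m \<noteq> 0" "m \<noteq> 1" by (auto intro: Nat.gr0I)
  have "\<forall>d\<in>{2..<29}. \<not> d dvd (797::nat)" unfolding atLeastLessThan_upt by simp
  then have small: "d \<notin> {2..<29}" if "d dvd 797" for d :: nat using that by blast
  have "n \<notin> {2..<29}" "m \<notin> {2..<29}" using small[of n] small[of m] n(3) by simp_all
  \<comment> \<open>Both factors exceed the square root of 797.\<close>
  then have "29 \<le> n" "29 \<le> m" using n(1) \<open>m \<noteq> 0\<close> \<open>m \<noteq> 1\<close> by auto
  then show False using n(3) mult_le_mono[of 29 n 29 m] by linarith
qed

interpretation P797: paley_prime 797
  by unfold_locales (rule prime_797, simp add: cong_def)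

lemma Legendre_2_797: "Legendre 2 797 = -1"
proof -
  have "[(2::int) ^ 398 = -1] (mod 797)" by (simp add: cong_def)
  then have "[Legendre 2 (int 797) = -1] (mod int 797)"
    using euler_criterion[OF prime_797, of 2] by (auto intro: cong_trans)
  then show ?thesis using Legendre_eqI[OF prime_797 _, of 2 "-1"] by simp
qed

lemma squares_797: "list_all (\<lambda>i. Legendre (i * i mod 797) 797 = 1) [1..398]"
proof -
  have "Legendre (i * i mod 797) 797 = 1" if "i \<in> {1..398}" for i
  proof -
    have "\<not> int 797 dvd i" using that zdvd_not_zless[of i 797] by auto
    then have "Legendre (i * i) (int 797) = 1" by (intro Legendre_square[OF prime_797]) auto
    moreover have "Legendre (i * i mod 797) 797 = Legendre (i * i) 797" by (rule Legendre_cong) (simp add: cong_def)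
    ultimately show ?thesis by simp
  qed
  then show ?thesis unfolding list_all_iff set_map set_upto by blast
qed

lemma nonsquares_797: "list_all (\<lambda>i. Legendre (2 * (i * i mod 797) mod 797) 797 \<noteq> 1) [1..398]"
proof -
  have "Legendre (2 * (i * i mod 797) mod 797) 797 = -1" if "i \<in> {1..398}" for i
  proof -
    have "Legendre (2 * (i * i mod 797) mod 797) 797 = Legendre (2 * (i * i mod 797)) (int 797)"
      by (simp, rule Legendre_cong) (simp add: cong_def)
    also have "\<dots> = Legendre 2 (int 797) * Legendre (i * i mod 797) (int 797)" by (rule P797.mult)
    also have "\<dots> = -1" using squares_797 that unfolding list_all_iff set_map set_upto by (simp add: Legendre_2_797)
    finally show ?thesis .
  qed
  then show ?thesis unfolding list_all_iff set_map set_upto by simp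
qed

lemma Legendre_797_neg: "Legendre (- numeral n) 797 = Legendre (numeral n) 797" "Legendre (-1) 797 = Legendre 1 797"
  using P797.minus[of "numeral n"] P797.minus[of 1] by simp_all

definition paley_797 :: "int \<Rightarrow> int \<Rightarrow> bool" where
  "paley_797 u v \<longleftrightarrow> Legendre (u - v) 797 = 1"

lemma paley_797: "P797.paley = paley_797"
  by (intro ext) (simp add: P797.paley_def paley_797_def)

text \<open>
  Evaluating these two lists yields one rewrite rule for each nonzero residue class.
\<close>

lemmas table_797 =
  squares_797[unfolded upto.simps[of 1], simplified]
  nonsquares_797[unfolded upto.simps[of 1], simplified]

text \<open>
  The common neighbours of 0 and 1, sorted into orbits of ratios; the heads are the least
  elements.
\<close>

definition orbits_797 :: "int list list" where
 "orbits_797 = [[10,788,558,240,177,621],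
   [11,787,145,653,239,559],
   [14,784,57,741,613,185],
   [15,783,372,426,740,58],
   [16,782,548,250,425,373],
   [17,781,422,376,249,549],
   [25,773,542,256,166,632],
   [36,762,155,643,296,502],
   [41,757,486,312,259,539],
   [44,754,634,164,278,520],
   [61,737,196,602,704,94],
   [62,736,90,708,601,197],
   [67,731,571,227,640,158],
   [68,730,504,294,226,572],
   [69,729,566,232,293,505],
   [74,724,657,141,131,667],
   [95,703,646,152,195,603],
   [96,702,357,441,151,647],
   [100,698,534,264,161,637],
   [103,695,325,473,461,337],
   [107,691,581,217,203,595],
   [110,688,413,385,680,118],
   [111,687,438,360,384,414],
   [127,671,182,616,525,273],
   [144,654,238,560,418,380],
   [153,645,224,574,194,604],
   [154,644,295,503,573,225],
   [159,639,396,402,570,228],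
   [160,638,533,265,401,397],
   [165,633,541,257,277,521],
   [170,628,361,437,415,383],
   [233,565,431,367,292,506],
   [258,540,485,313,276,522]]"

lemma orbits_797: "\<forall>B\<in>set orbits_797. P797.orbit B \<and> set B \<subseteq> {0..<int 797}"
  by (simp add: orbits_797_def P797.orbit_def cong_def)

lemma orbits_797_complete:
  "list_all (\<lambda>l. if Legendre l 797 = 1 then if Legendre (l - 1) 797 = 1
      then l \<in> set (concat orbits_797) else True else True) [2..796]"
  by (simp add: orbits_797_def table_797 Legendre_797_neg)

text \<open>
  Together with \<open>0\<close>, \<open>1\<close> and the head of an orbit, a 7-clique would give a 10-clique.
\<close>

lemma sweep_797: "sweep paley_797 7 orbits_797 []"
  unfolding orbits_797_def
  by (simp only: sweep.simps concat.simps append.simps list.sel filter.simps rows.simps list.map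
    paley_797_def table_797 Legendre_797_neg arith_simps rel_simps numeral_One[where ?'a = int]
    search_simps cong: if_weak_cong)

lemma paley_797_clique:
  assumes "clique_of P797.paley Q" shows "card Q \<noteq> 10"
proof
  assume card: "card Q = 10"
  have "card Q \<noteq> 7 + 3"
  proof (rule P797.sweep_orbits_sound[OF sweep_797[folded paley_797] orbits_797 assms])
    show "3 \<le> card Q" using card by simp
    fix l assume l: "l \<in> {0..<int 797}" "P797.paley l 0" "P797.paley l 1"
    then have "l \<noteq> 0" "l \<noteq> 1" by (auto simp: paley_797 paley_797_def Legendre_eq_0_iff[THEN iffD2])
    then have "l \<in> {2..796}" using l(1) by auto
    then have "if Legendre l 797 = 1 then if Legendre (l - 1) 797 = 1
        then l \<in> set (concat orbits_797) else True else True"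
      by (rule bspec[OF orbits_797_complete[unfolded list_all_iff set_upto]])
    then show "l \<in> set (concat orbits_797)"
      using l(2,3) by (simp only: paley_797 paley_797_def diff_0_right if_True simp_thms)
  qed
  then show False using card by simp
qed

lemma doubled_797_clique:
  assumes "Q \<subseteq> P797.double_points" "clique_of (\<lambda>u v. P797.doubled u v = s) Q"
  shows "card Q \<noteq> 11"
proof -
  have "card S \<noteq> 10" if "S \<subseteq> {0..<int 797}" "clique_of (\<lambda>u v. P797.paley u v = s) S" for s S
    using P797.paley_self_complementary[OF paley_797_clique _ that] Legendre_2_797 by simp
  from P797.doubled_clique[OF this assms] show ?thesis by simp
qed

text \<open>
  A 9-clique of the Paley graph, and its double, which is a 9-clique of the complement as 2 is not
  a square.
\<close>

definition clique_797 :: "bool \<Rightarrow> int list" where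
  "clique_797 s = map (\<lambda>c. if s then c else 2 * c) [0, 1, 10, 11, 25, 68, 155, 170, 195]"

lemma clique_797:
  assumes "i < 9" "j < 9" "i \<noteq> j"
  shows "P797.paley (clique_797 s ! i) (clique_797 s ! j) = s"
proof -
  have "\<forall>i\<in>{0,1,2,3,4,5,6,7,8}. \<forall>j\<in>{0,1,2,3,4,5,6,7,8}. i \<noteq> j \<longrightarrow>
      P797.paley (clique_797 s ! i) (clique_797 s ! j) = s"
    by (cases s)
      (simp_all add: clique_797_def paley_797 paley_797_def table_797 Legendre_797_neg)
  moreover have "i \<in> {0,1,2,3,4,5,6,7,8}" "j \<in> {0,1,2,3,4,5,6,7,8}" using assms by auto
  ultimately show ?thesis using assms(3) by blast
qed

lemma clique_797_range: "i < 9 \<Longrightarrow> clique_797 s ! i \<in> {0..<797}"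
proof -
  assume "i < 9"
  moreover have "\<forall>i\<in>{0,1,2,3,4,5,6,7,8}. clique_797 s ! i \<in> {0..<797}"
    by (simp add: clique_797_def)
  moreover have "i \<in> {0,1,2,3,4,5,6,7,8}" using \<open>i < 9\<close> by auto
  ultimately show ?thesis by blast
qed

section \<open>The gadget\<close>

text \<open>
  The gadget has five zone, nine leaf, nine shade and eleven spoke vertices. Its edges were found
  by a computer search under the requirement that the cyclic group of order 9 acts on the leaves,
  the shades and the first nine spokes. What matters is the following: the zone vertices form a
  pentagon, a leaf is joined to its shade, the leaves and \<open>Zone 0\<close> are pairwise not joined, nor
  are the spokes, there is no triangle, and independent sets that contain a spoke are small.
\<close>

datatype gadget = Zone nat | Leaf nat | Shade nat | Spoke nat

fun arc :: "gadget \<Rightarrow> gadget \<Rightarrow> bool" where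
  "arc (Zone i) (Zone j) \<longleftrightarrow> j = (i + 2) mod 5"
| "arc (Shade i) (Leaf j) \<longleftrightarrow> j = i \<or> j = (i + 5) mod 9"
| "arc (Shade i) (Shade j) \<longleftrightarrow> j = (i + 1) mod 9"
| "arc (Spoke a) (Leaf j) \<longleftrightarrow> a \<ge> 9 \<or> j = a \<or> j = (a + 1) mod 9 \<or> j = (a + 2) mod 9"
| "arc (Spoke a) (Shade j) \<longleftrightarrow> a < 9 \<and> (j = (a + 3) mod 9 \<or> j = (a + 8) mod 9)"
| "arc (Spoke a) (Zone k) \<longleftrightarrow>
     (if a < 9 then k = 2 \<or> k = 3 else if a = 9 then k = 0 \<or> k = 1 else k = 0 \<or> k = 4)"
| "arc _ _ \<longleftrightarrow> False"

definition linked :: "gadget \<Rightarrow> gadget \<Rightarrow> bool" where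
  "linked u v \<longleftrightarrow> arc u v \<or> arc v u"

lemma linked_sym: "linked u v = linked v u" by (auto simp: linked_def)

definition rim :: "gadget set" where
  "rim = Zone ` {..<5} \<union> Leaf ` {..<9} \<union> Shade ` {..<9}"

lemma rim_iff [simp]: "Zone k \<in> rim \<longleftrightarrow> k < 5" "Leaf i \<in> rim \<longleftrightarrow> i < 9" "Shade i \<in> rim \<longleftrightarrow> i < 9"
  "Spoke a \<notin> rim"
  by (auto simp: rim_def)

definition rim_list :: "gadget list" where
  "rim_list = map Shade [0..<9] @ map Leaf [0..<9] @ map Zone [0..<5]"

lemma set_rim_list: "set rim_list = rim" by (auto simp: rim_list_def rim_def)

text \<open>
  The first rewriting computes the adjacency rows, the second one runs the search on them.
\<close>

lemma triangle_search: "clique_free 3 (rows linked (map Spoke [0..<11] @ rim_list))"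
  by (simp add: rim_list_def linked_def upt_rec del: clique_free.simps)
    (simp only: search_simps)

lemma independent_search: "sweep (\<lambda>u v. \<not> linked u v) 11 (map (\<lambda>h. [h]) (map Spoke [0..<11])) rim_list"
  by (simp add: rim_list_def linked_def upt_rec del: clique_free.simps)
    (simp only: search_simps)

lemma independent_search_even: "sweep (\<lambda>u v. \<not> linked u v) 10 (map (\<lambda>h. [h]) (map Spoke [0,2,4,6,8,10])) rim_list"
  by (simp add: rim_list_def linked_def upt_rec del: clique_free.simps)
    (simp only: search_simps)

lemma independent_search_odd: "sweep (\<lambda>u v. \<not> linked u v) 10 (map (\<lambda>h. [h]) (map Spoke [1,3,5,7,9])) rim_list"
  by (simp add: rim_list_def linked_def upt_rec del: clique_free.simps)
    (simp only: search_simps)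

lemma triangle_free:
  assumes "S \<subseteq> rim \<union> Spoke ` {..<11}" "clique_of linked S" shows "card S \<noteq> 3"
  using clique_free_sound[OF triangle_search _ assms(2)] assms(1) by (auto simp: set_rim_list lessThan_atLeast0)

lemma independent_bound:
  assumes "S \<subseteq> rim \<union> Spoke ` {..<11}" "clique_of (\<lambda>u v. \<not> linked u v) S" "a < 11" "Spoke a \<in> S"
  shows "card S \<noteq> 12"
  using sweep_singletons_sound[OF independent_search _ assms(2)] assms(1,3,4) by (force simp: set_rim_list lessThan_atLeast0)

text \<open>
  Independent sets with 11 vertices exist, for example the set of all spokes, but those that
  contain a spoke contain spokes of both parities.
\<close>

lemma independent_bound_parity:
  assumes "S \<subseteq> rim \<union> Spoke ` {a. a < 11 \<and> even a = e}" "clique_of (\<lambda>u v. \<not> linked u v) S" "a < 11" "Spoke a \<in> S"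
  shows "card S \<noteq> 11"
proof -
  have even: "{a::nat. a < 11 \<and> even a} = {0,2,4,6,8,10}" 
    by (rule Set.set_eqI, simp, presburger)
  have odd: "{a::nat. a < 11 \<and> odd a} = {1,3,5,7,9}" 
    by (rule Set.set_eqI, simp, presburger)
  have a: "Spoke a \<in> Spoke ` {a. a < 11 \<and> even a = e}" using assms by auto
  show ?thesis
  proof (cases e)
    case True
    have "card S \<noteq> Suc 10"
    proof (rule sweep_singletons_sound[OF independent_search_even _ assms(2)])
      show "S \<subseteq> set (map Spoke [0,2,4,6,8,10]) \<union> set rim_list"
        using assms(1) True by (simp add: even set_rim_list sup_commute)
      show "S \<inter> set (map Spoke [0,2,4,6,8,10]) \<noteq> {}"
        using a assms(4) True even by auto
    qed
    then show ?thesis by simp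
  next
    case False
    have "card S \<noteq> Suc 10"
    proof (rule sweep_singletons_sound[OF independent_search_odd _ assms(2)])
      show "S \<subseteq> set (map Spoke [1,3,5,7,9]) \<union> set rim_list"
        using assms(1) False by (simp add: odd set_rim_list sup_commute)
      show "S \<inter> set (map Spoke [1,3,5,7,9]) \<noteq> {}"
        using a assms(4) False odd by auto
    qed
    then show ?thesis by simp
  qed
qed

section \<open>Adding 44 points\<close>

text \<open>
  Multiplication by 2 modulo 5 maps the pentagon to its complement. Through this relabelling the
  copies of \<open>z\<close> can serve as zone vertices on both sides, although the colours are exchanged.
\<close>

definition skip :: "nat \<Rightarrow> nat" where "skip k = 2 * k mod 5"

lemma skip_lt [simp]: "skip k < 5" by (simp add: skip_def)

lemma skip_eq_iff: "1 \<le> i \<Longrightarrow> i \<le> 4 \<Longrightarrow> 1 \<le> j \<Longrightarrow> j \<le> 4 \<Longrightarrow> skip i = skip j \<longleftrightarrow> i = j"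
  unfolding skip_def by presburger

lemma skip_pos: "1 \<le> i \<Longrightarrow> i \<le> 4 \<Longrightarrow> skip i \<noteq> 0"
  unfolding skip_def by presburger

text \<open>
  \<open>Core z\<close> together with the four \<open>Fibre\<close> points are the copies of \<open>z\<close>. The Boolean of \<open>Twin\<close> and
  \<open>Hub\<close> names the side, \<open>True\<close> for red.
\<close>

datatype 'v ext = Core 'v | Fibre nat | Twin bool nat | Hub bool nat

text \<open>
  For both colours \<open>s\<close>, the points \<open>z\<close> and \<open>leaf s 0, \<dots>, leaf s 8\<close> form a 10-clique of colour \<open>s\<close>.
\<close>

locale core_colouring =
  fixes V :: "'v set" and col :: "'v \<Rightarrow> 'v \<Rightarrow> bool" and z :: 'v and leaf :: "bool \<Rightarrow> nat \<Rightarrow> 'v"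
  assumes finite_V: "finite V"
    and col_sym: "col u v = col v u"
    and no_clique: "\<And>s S. S \<subseteq> V \<Longrightarrow> clique_of (\<lambda>u v. col u v = s) S \<Longrightarrow> card S \<noteq> 11"
    and z_in: "z \<in> V"
    and leaf_in: "\<And>s i. i < 9 \<Longrightarrow> leaf s i \<in> V"
    and leaf_z: "\<And>s i. i < 9 \<Longrightarrow> leaf s i \<noteq> z"
    and col_z_leaf: "\<And>s i. i < 9 \<Longrightarrow> col z (leaf s i) = s"
    and leaf_inj: "\<And>s i j. i < 9 \<Longrightarrow> j < 9 \<Longrightarrow> i \<noteq> j \<Longrightarrow> leaf s i \<noteq> leaf s j"
    and col_leaf: "\<And>s i j. i < 9 \<Longrightarrow> j < 9 \<Longrightarrow> i \<noteq> j \<Longrightarrow> col (leaf s i) (leaf s j) = s"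
begin

lemma leaf_eq_iff: assumes "i < 9" "j < 9" shows "leaf s i = leaf t j \<longleftrightarrow> s = t \<and> i = j"
proof
  assume a: "leaf s i = leaf t j"
  then have "s = t" using col_z_leaf[OF assms(1), of s] col_z_leaf[OF assms(2), of t] by simp
  then show "s = t \<and> i = j" using a assms leaf_inj[of i j s] by auto
qed auto

text \<open>
  The gadget vertex that a point represents on side \<open>s\<close>, if it belongs to that side.
\<close>

fun role :: "bool \<Rightarrow> 'v ext \<Rightarrow> gadget option" where
  "role s (Core v) = (if v = z then Some (Zone 0)
     else if \<exists>i<9. v = leaf s i then Some (Leaf (THE i. i < 9 \<and> v = leaf s i)) else None)"
| "role s (Fibre k) = Some (Zone (if s then k else skip k))"
| "role s (Twin t i) = (if t = s then Some (Shade i) else None)"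
| "role s (Hub t a) = (if t = s then Some (Spoke a) else None)"

text \<open>
  The core point that a point copies. Hubs copy nothing, and \<open>z\<close> is a default value for them.
\<close>

fun proj :: "'v ext \<Rightarrow> 'v" where
  "proj (Core v) = v"
| "proj (Fibre k) = z"
| "proj (Twin s i) = leaf s i"
| "proj (Hub s a) = z"

text \<open>
  The colour of pairs that do not lie within one side. By the parity rule, the opposite hubs to
  which a hub has a given colour all have the same parity, which is the situation of
  \<open>independent_bound_parity\<close>.
\<close>

fun hub_colour :: "'v ext \<Rightarrow> 'v ext \<Rightarrow> bool" where
  "hub_colour (Hub s a) (Hub t b) = even (a + b)"
| "hub_colour (Hub s a) v = (\<not> s)"
| "hub_colour u (Hub s a) = (\<not> s)"
| "hub_colour u v = col (proj u) (proj v)"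

definition ecol :: "'v ext \<Rightarrow> 'v ext \<Rightarrow> bool" where
  "ecol u v = (case (role True u, role True v) of
      (Some x, Some y) \<Rightarrow> \<not> linked x y
    | _ \<Rightarrow> (case (role False u, role False v) of
        (Some x, Some y) \<Rightarrow> linked x y
      | _ \<Rightarrow> hub_colour u v))"

definition ext_points :: "'v ext set" where
  "ext_points = Core ` V \<union> Fibre ` {1..4} \<union> (\<lambda>(s, i). Twin s i) ` (UNIV \<times> {..<9})
     \<union> (\<lambda>(s, a). Hub s a) ` (UNIV \<times> {..<11})"

lemma hub_colour_sym: "hub_colour u v = hub_colour v u"
  by (cases u; cases v) (auto simp: col_sym add.commute)

lemma ecol_sym: "ecol u v = ecol v u"
  by (auto simp: ecol_def linked_sym hub_colour_sym split: option.splits)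

lemma finite_ext_points: "finite ext_points"
  unfolding ext_points_def using finite_V by auto

lemma card_ext_points: "card ext_points = card V + 44"
proof -
  define A B C D where "A = Core ` V" and "B = (Fibre ` {1..4} :: 'v ext set)"
    and "C = ((\<lambda>(s, i). Twin s i) ` (UNIV \<times> {..<9}) :: 'v ext set)"
    and "D = ((\<lambda>(s, a). Hub s a) ` (UNIV \<times> {..<11}) :: 'v ext set)"
  note defs = A_def B_def C_def D_def
  have parts: "ext_points = A \<union> B \<union> C \<union> D" by (simp add: ext_points_def defs)
  have fin: "finite A" "finite B" "finite C" "finite D"
    using finite_V by (simp_all add: defs)
  have disj: "A \<inter> B = {}" "(A \<union> B) \<inter> C = {}" "(A \<union> B \<union> C) \<inter> D = {}"
    by (auto simp: defs)
  have "card A = card V" "card B = 4" unfolding defs by (subst card_image; auto simp: inj_on_def)+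
  moreover have "card C = 18" "card D = 22"
    unfolding defs by (subst card_image; auto simp: inj_on_def card_cartesian_product)+
  ultimately show ?thesis by (simp add: parts card_Un_disjoint fin disj)
qed

lemma role_Core: "role s (Core v) = Some x \<longleftrightarrow> v = z \<and> x = Zone 0 \<or> (\<exists>i<9. v = leaf s i \<and> x = Leaf i)"
proof (cases "\<exists>i<9. v = leaf s i")
  case True
  then obtain i where i: "i < 9" "v = leaf s i" by blast
  then have "(THE i. i < 9 \<and> v = leaf s i) = i" by (intro the_equality) (auto simp: leaf_eq_iff)
  then have "role s (Core v) = Some (Leaf i)" using i leaf_z[of i s] by auto
  moreover have "(\<exists>j<9. v = leaf s j \<and> x = Leaf j) \<longleftrightarrow> x = Leaf i" using i by (auto simp: leaf_eq_iff)
  ultimately show ?thesis using i leaf_z[of i s] by auto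
next
  case False
  then show ?thesis by auto
qed

declare role.simps(1) [simp del] role_Core [simp]

lemma role_range:
  assumes "u \<in> ext_points" "role s u = Some x" shows "x \<in> rim \<union> Spoke ` {..<11}"
  using assms by (cases u) (auto simp: ext_points_def split: if_splits)

lemma role_inj:
  assumes "u \<in> ext_points" "v \<in> ext_points" "role s u = Some x" "role s v = Some x"
  shows "u = v"
  using assms by (cases u; cases v) (auto simp: ext_points_def skip_eq_iff skip_pos split: if_splits)

lemma skip_linked:
  assumes "i < 5" "j < 5" "i \<noteq> j"
  shows "linked (Zone (skip i)) (Zone (skip j)) \<longleftrightarrow> \<not> linked (Zone i) (Zone j)"
proof -
  have "\<forall>i\<in>{0,1,2,3,4}. \<forall>j\<in>{0,1,2,3,4}. i \<noteq> j \<longrightarrow>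
      linked (Zone (skip i)) (Zone (skip j)) \<longleftrightarrow> \<not> linked (Zone i) (Zone j)"
    by (simp add: linked_def skip_def)
  moreover have "i \<in> {0,1,2,3,4}" "j \<in> {0,1,2,3,4}" using assms by auto
  ultimately show ?thesis using assms(3) by blast
qed

lemma role_both: "u \<in> ext_points \<Longrightarrow> role True u = Some x \<Longrightarrow> role False u = Some y
    \<Longrightarrow> \<exists>i<5. x = Zone i \<and> y = Zone (skip i)"
  by (cases u) (auto simp: ext_points_def leaf_eq_iff leaf_z leaf_z[symmetric] skip_def split: if_splits)

text \<open>
  Both sides obey the same rule. This is not built into the definition for two copies of \<open>z\<close>,
  which lie on both sides; there it holds because \<open>skip\<close> exchanges edges and non-edges of the
  pentagon.
\<close>

lemma ecol_role:
  assumes "u \<in> ext_points" "v \<in> ext_points" "u \<noteq> v" "role s u = Some x" "role s v = Some y"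
  shows "ecol u v = s \<longleftrightarrow> \<not> linked x y"
proof (cases s)
  case True
  then show ?thesis using assms by (simp add: ecol_def)
next
  case False
  show ?thesis
  proof (cases "role True u = None \<or> role True v = None")
    case True
    then show ?thesis using False assms by (auto simp: ecol_def split: option.split)
  next
    case both: False
    then obtain x' y' where xy': "role True u = Some x'" "role True v = Some y'" by auto
    obtain i j where ij: "i < 5" "x' = Zone i" "x = Zone (skip i)" "j < 5" "y' = Zone j" "y = Zone (skip j)"
      using role_both[OF assms(1) xy'(1)] role_both[OF assms(2) xy'(2)] assms(4,5) False by auto
    have "i \<noteq> j" using role_inj[OF assms(1,2) xy'(1)] xy'(2) ij assms(3) by auto
    then show ?thesis using skip_linked ij xy' False by (simp add: ecol_def)
  qed
qed

lemma ecol_hub: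
  assumes "v \<in> ext_points" "role s v = None" "\<forall>b. v \<noteq> Hub (\<not> s) b"
  shows "ecol (Hub s a) v = (\<not> s)"
  using assms by (cases s; cases v) (auto simp: ecol_def split: option.split)

lemma ecol_hubs: "ecol (Hub s a) (Hub (\<not> s) b) \<longleftrightarrow> even (a + b)"
  by (cases s) (auto simp: ecol_def)

lemma role_proj:
  assumes "u \<in> ext_points" "\<forall>s a. u \<noteq> Hub s a" "role t u = Some x"
  obtains k where "x = Zone k" "proj u = z" "role (\<not> t) u \<noteq> None"
    | i where "i < 9" "x = Leaf i \<or> x = Shade i" "proj u = leaf t i"
  using assms by (cases u) (auto simp: ext_points_def split: if_splits)

lemma role_fibre:
  assumes "w \<in> ext_points" "\<forall>s a. w \<noteq> Hub s a"
  shows role_fibre_z: "proj w = z \<Longrightarrow> role t w \<noteq> None"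
    and role_fibre_leaf: "i < 9 \<Longrightarrow> proj w = leaf t i \<Longrightarrow> role t w \<noteq> None"
proof -
  show "role t w \<noteq> None" if "proj w = z"
  proof (cases w)
    case (Twin s i)
    then show ?thesis using that assms(1) leaf_z[of i s] by (auto simp: ext_points_def)
  qed (use that assms in auto)
  show "role t w \<noteq> None" if "i < 9" "proj w = leaf t i"
  proof (cases w)
    case (Twin s j)
    then show ?thesis using that assms(1) by (auto simp: ext_points_def leaf_eq_iff)
  next
    case (Fibre k)
    then show ?thesis using that leaf_z[of i t] by auto
  qed (use that assms in auto)
qed

lemma proj_eqD:
  assumes "u \<in> ext_points" "v \<in> ext_points" "u \<noteq> v" "\<forall>s a. u \<noteq> Hub s a" "\<forall>s a. v \<noteq> Hub s a" "proj u = proj v"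
  shows "\<exists>t. role t u \<noteq> None \<and> role t v \<noteq> None"
proof -
  have "w = Core (proj w) \<or> proj w = z \<or> (\<exists>t i. i < 9 \<and> proj w = leaf t i)"
    if "w \<in> ext_points" "\<forall>s a. w \<noteq> Hub s a" for w
    using that by (cases w) (auto simp: ext_points_def)
  then have "proj u = z \<or> (\<exists>t i. i < 9 \<and> proj u = leaf t i)"
    using assms by metis
  then show ?thesis
    using role_fibre[OF assms(1,4)] role_fibre[OF assms(2,5)] assms(6) by metis
qed

text \<open>
  Within the opposite side the colour is prescribed by the gadget, not by the core. It can only
  disagree with the core harmlessly: a leaf and its twin are linked, so they do not have colour
  \<open>\<not> s\<close>, and the core points \<open>z\<close> and \<open>leaf (\<not> s) i\<close> have mutual colour \<open>\<not> s\<close> anyway.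
\<close>

lemma ecol_proj:
  assumes "u \<in> ext_points" "v \<in> ext_points" "u \<noteq> v" "\<forall>s a. u \<noteq> Hub s a" "\<forall>s a. v \<noteq> Hub s a"
    and no: "role s u = None \<or> role s v = None" and col: "ecol u v = (\<not> s)"
  shows "proj u \<noteq> proj v \<and> col (proj u) (proj v) = (\<not> s)"
proof (cases "role (\<not> s) u \<noteq> None \<and> role (\<not> s) v \<noteq> None")
  case True
  then obtain x y where xy: "role (\<not> s) u = Some x" "role (\<not> s) v = Some y" by auto
  have nl: "\<not> linked x y" using ecol_role[OF assms(1-3) xy] col by simp
  have "x \<noteq> y" using role_inj[OF assms(1,2) xy(1)] xy(2) assms(3) by auto
  from role_proj[OF assms(1,4) xy(1)] show ?thesis
  proof cases
    case (1 k)
    note u = 1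
    from role_proj[OF assms(2,5) xy(2)] show ?thesis
    proof cases
      case (1 l) with u no show ?thesis by auto
    next
      case (2 j) with u show ?thesis using leaf_z[of j "\<not> s"] col_z_leaf[of j "\<not> s"] by auto
    qed
  next
    case (2 i)
    note u = 2
    from role_proj[OF assms(2,5) xy(2)] show ?thesis
    proof cases
      case (1 l) with u show ?thesis using leaf_z[of i "\<not> s"] col_z_leaf[of i "\<not> s"] by (simp add: col_sym[of _ z])
    next
      case (2 j)
      have "i \<noteq> j" using nl \<open>x \<noteq> y\<close> u 2 by (auto simp: linked_def)
      then show ?thesis using u 2 by (simp add: leaf_eq_iff col_leaf)
    qed
  qed
next
  case False
  then have "ecol u v = hub_colour u v"
    using no by (cases s) (auto simp: ecol_def split: option.splits)
  also have "\<dots> = col (proj u) (proj v)" using assms(4,5) by (cases u; cases v) auto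
  finally have c: "col (proj u) (proj v) = (\<not> s)" using col by simp
  have "proj u \<noteq> proj v"
  proof
    assume "proj u = proj v"
    from proj_eqD[OF assms(1-5) this] obtain t where "role t u \<noteq> None" "role t v \<noteq> None" by blast
    then show False using no False by (cases "t = s") auto
  qed
  then show ?thesis using c by blast
qed

lemma role_Hub_iff: "role s u = Some (Spoke a) \<longleftrightarrow> u = Hub s a"
  by (cases u) auto

lemma linked_image:
  assumes "Q \<subseteq> ext_points" "clique_of (\<lambda>u v. ecol u v = c) Q" "Q \<subseteq> {u. role s u \<noteq> None}"
  defines "S \<equiv> (\<lambda>u. the (role s u)) ` Q"
  shows "S \<subseteq> rim \<union> Spoke ` {..<11}" "card S = card Q"
    "clique_of (\<lambda>x y. linked x y = (c \<noteq> s)) S"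
proof -
  have some: "role s u = Some (the (role s u))" "u \<in> ext_points" if "u \<in> Q" for u
    using that assms(1,3) by auto
  show "S \<subseteq> rim \<union> Spoke ` {..<11}"
    unfolding S_def using role_range[OF some(2) some(1)] by blast
  have "inj_on (\<lambda>u. the (role s u)) Q"
  proof (rule inj_onI)
    fix u v assume "u \<in> Q" "v \<in> Q" "the (role s u) = the (role s v)"
    then show "u = v" using role_inj[OF some(2) some(2) some(1)] some(1)[of v] by simp
  qed
  then show "card S = card Q" unfolding S_def by (rule card_image)
  show "clique_of (\<lambda>x y. linked x y = (c \<noteq> s)) S"
    unfolding clique_of_def
  proof (intro ballI impI)
    fix x y assume "x \<in> S" "y \<in> S" "x \<noteq> y"
    then obtain u v where uv: "u \<in> Q" "v \<in> Q" "x = the (role s u)" "y = the (role s v)"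
      unfolding S_def by blast
    then have uv: "u \<in> Q" "v \<in> Q" "u \<noteq> v" "role s u = Some x" "role s v = Some y"
      using some(1) \<open>x \<noteq> y\<close> by auto
    then have "ecol u v = c" using assms(2) by (auto simp: clique_of_def)
    moreover have "ecol u v = s \<longleftrightarrow> \<not> linked x y" using ecol_role[OF some(2) some(2), OF uv] .
    ultimately show "linked x y = (c \<noteq> s)" by auto
  qed
qed

lemma linked_Spoke: "\<not> linked (Spoke a) (Spoke b)" by (simp add: linked_def)

lemma ecol_same_hubs: "Hub s a \<in> ext_points \<Longrightarrow> Hub s b \<in> ext_points \<Longrightarrow> a \<noteq> b \<Longrightarrow> ecol (Hub s a) (Hub s b) = s"
  using ecol_role[of "Hub s a" "Hub s b" s "Spoke a" "Spoke b"] by (simp add: linked_Spoke)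

text \<open>
  Side \<open>s\<close> is met in a clique of the gadget, that is in at most two points. If one of them is not
  a hub, it is kept and the other one dropped; otherwise there is at most one, since the hubs of
  side \<open>s\<close> have mutual colour \<open>s\<close>, and it is dropped. The remaining points, at least 11, project
  injectively to the core.
\<close>

lemma no_clique_without_far_hub:
  assumes Q: "Q \<subseteq> ext_points" "clique_of (\<lambda>u v. ecol u v = (\<not> s)) Q" and "\<forall>b. Hub (\<not> s) b \<notin> Q"
  shows "card Q \<noteq> 12"
proof
  assume card: "card Q = 12"
  then have fin: "finite Q" using card.infinite by fastforce
  define A where "A = {u\<in>Q. role s u \<noteq> None}"
  have two: "card T \<noteq> 3" if "T \<subseteq> A" for T
  proof -
    have "T \<subseteq> ext_points" "clique_of (\<lambda>u v. ecol u v = (\<not> s)) T" "T \<subseteq> {u. role s u \<noteq> None}"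
      using that Q(1) clique_of_subset[OF Q(2), of T] by (auto simp: A_def)
    from linked_image[OF this] show ?thesis using triangle_free by auto
  qed
  have "card A \<le> 2"
  proof (rule ccontr)
    assume "\<not> card A \<le> 2"
    then obtain T where "T \<subseteq> A" "card T = 3" using obtain_subset_with_card_n[of 3 A] by auto
    then show False using two by blast
  qed
  have finA: "finite A" and AQ: "A \<subseteq> Q" using fin by (auto simp: A_def)
  have nohub: "u \<noteq> Hub t a" if "u \<in> Q - A" for u t a
  proof
    assume u: "u = Hub t a"
    then have "t = (\<not> s)" using that by (cases "t = s") (auto simp: A_def)
    then show False using assms(3) that u by auto
  qed
  obtain P where P: "P \<subseteq> Q" "11 \<le> card P" "\<forall>u\<in>P. \<forall>t a. u \<noteq> Hub t a"
    "\<And>u v. u \<in> P \<Longrightarrow> v \<in> P \<Longrightarrow> u \<noteq> v \<Longrightarrow> role s u = None \<or> role s v = None"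
  proof (cases "\<exists>v\<in>A. \<forall>t a. v \<noteq> Hub t a")
    case True
    then obtain v where v: "v \<in> A" "\<forall>t a. v \<noteq> Hub t a" by blast
    have "card (insert v (Q - A)) = card Q - card A + 1"
      using v fin finA AQ by (simp add: card_Diff_subset)
    then have "11 \<le> card (insert v (Q - A))" using card \<open>card A \<le> 2\<close> by simp
    then show ?thesis
      using v AQ nohub by (intro that[of "insert v (Q - A)"]) (auto simp: A_def)
  next
    case False
    have "card A \<le> 1"
    proof (rule ccontr)
      assume "\<not> card A \<le> 1"
      then obtain T where "T \<subseteq> A" "card T = 2" using obtain_subset_with_card_n[of 2 A] by auto
      then obtain u v where uv: "u \<in> A" "v \<in> A" "u \<noteq> v" by (auto simp: card_2_iff)
      then obtain t a t' b where "u = Hub t a" "v = Hub t' b" using False by blast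
      then have ab: "u = Hub s a" "v = Hub s b"
        using uv by (auto simp: A_def split: if_splits)
      have "u \<in> ext_points" "v \<in> ext_points" using uv AQ Q(1) by auto
      then have "ecol u v = s" using ecol_same_hubs[of s a b] ab uv(3) by simp
      then show False using uv AQ Q by (auto simp: clique_of_def)
    qed
    then have "11 \<le> card (Q - A)" using card finA AQ by (simp add: card_Diff_subset)
    then show ?thesis using nohub by (intro that[of "Q - A"]) (auto simp: A_def)
  qed
  have pr: "proj u \<noteq> proj v \<and> col (proj u) (proj v) = (\<not> s)" if "u \<in> P" "v \<in> P" "u \<noteq> v" for u v
  proof (rule ecol_proj)
    have "u \<in> Q" "v \<in> Q" using that P(1) by auto
    then show "u \<in> ext_points" "v \<in> ext_points" "ecol u v = (\<not> s)" using that(3) Q by (auto simp: clique_of_def)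
  qed (use that P(3,4) in auto)
  then have "inj_on proj P" by (auto intro!: inj_onI)
  then have "11 \<le> card (proj ` P)" using P(2) by (simp add: card_image)
  then obtain S where S: "S \<subseteq> proj ` P" "card S = 11" using obtain_subset_with_card_n[of 11 "proj ` P"] by metis
  have "proj u \<in> V" if "u \<in> ext_points" "\<forall>t a. u \<noteq> Hub t a" for u
    using that z_in leaf_in by (cases u) (auto simp: ext_points_def)
  then have "proj ` P \<subseteq> V" using P(1,3) Q(1) by blast
  moreover have "clique_of (\<lambda>u v. col u v = (\<not> s)) (proj ` P)"
    using pr by (auto simp: clique_of_def)
  ultimately show False
    using S no_clique[of S "\<not> s"] clique_of_subset[of _ "proj ` P" S] by auto
qed

text \<open>
  A hub of the opposite side has colour \<open>s\<close> to all points outside that side other than the hubs of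
  side \<open>s\<close>, so the clique consists of an independent set of the opposite gadget and at most one
  hub of side \<open>s\<close>. The colour of that hub to the opposite hubs forces all of these to have the
  same parity.
\<close>

lemma no_clique_with_far_hub:
  assumes Q: "Q \<subseteq> ext_points" "clique_of (\<lambda>u v. ecol u v = (\<not> s)) Q" and b: "Hub (\<not> s) b \<in> Q"
  shows "card Q \<noteq> 12"
proof
  assume card: "card Q = 12"
  then have fin: "finite Q" using card.infinite by fastforce
  define H where "H = {u\<in>Q. \<exists>a. u = Hub s a}"
  have ecolQ: "ecol u v = (\<not> s)" if "u \<in> Q" "v \<in> Q" "u \<noteq> v" for u v
    using that Q by (auto simp: clique_of_def)
  have b11: "b < 11" using b Q(1) by (auto simp: ext_points_def)
  have role: "role (\<not> s) u \<noteq> None" if "u \<in> Q - H" for u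
  proof
    assume "role (\<not> s) u = None"
    then have "ecol (Hub (\<not> s) b) u = s" "u \<noteq> Hub (\<not> s) b"
      using ecol_hub[of u "\<not> s" b] that Q(1) by (auto simp: H_def)
    then show False using ecolQ[OF b] that by auto
  qed
  define S where "S = (\<lambda>u. the (role (\<not> s) u)) ` (Q - H)"
  have sub: "Q - H \<subseteq> ext_points" "clique_of (\<lambda>u v. ecol u v = (\<not> s)) (Q - H)" "Q - H \<subseteq> {u. role (\<not> s) u \<noteq> None}"
    using Q(1) role clique_of_subset[OF Q(2), of "Q - H"] by auto
  have S: "S \<subseteq> rim \<union> Spoke ` {..<11}" "card S = card (Q - H)" "clique_of (\<lambda>x y. \<not> linked x y) S"
    using linked_image[OF sub] by (auto simp: S_def)
  have bS: "Spoke b \<in> S" using b by (force simp: S_def H_def)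
  show False
  proof (cases "H = {}")
    case True
    then show False using independent_bound[OF S(1,3) b11 bS] S(2) card by simp
  next
    case False
    then obtain a where a: "Hub s a \<in> Q" by (auto simp: H_def)
    have "u = Hub s a" if uH: "u \<in> H" for u
    proof (rule ccontr)
      assume ne: "u \<noteq> Hub s a"
      obtain a' where u: "u = Hub s a'" "u \<in> Q" using uH by (auto simp: H_def)
      then have "ecol u (Hub s a) = s"
        using ecol_same_hubs[of s a' a] ne a Q(1) by auto
      then show False using ecolQ u a ne by auto
    qed
    then have "H = {Hub s a}" using a by (auto simp: H_def)
    then have "card S = 11" using S(2) card fin a by simp
    moreover have "S \<subseteq> rim \<union> Spoke ` {c. c < 11 \<and> even c = (even a = (\<not> s))}"
    proof
      fix x assume x: "x \<in> S"
      show "x \<in> rim \<union> Spoke ` {c. c < 11 \<and> even c = (even a = (\<not> s))}"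
      proof (cases "x \<in> rim")
        case False
        then obtain c where c: "c < 11" "x = Spoke c" using x S(1) by auto
        then obtain u where u: "u \<in> Q" "role (\<not> s) u = Some (Spoke c)"
          using x role by (fastforce simp: S_def)
        then have "Hub (\<not> s) c \<in> Q" by (simp add: role_Hub_iff)
        then have "even (a + c) = (\<not> s)" using ecolQ[OF a, of "Hub (\<not> s) c"] by (simp add: ecol_hubs)
        then show ?thesis using c by auto
      qed simp
    qed
    ultimately show False using independent_bound_parity[OF _ S(3) b11 bS] by blast
  qed
qed

theorem no_clique_ext_points: "Q \<subseteq> ext_points \<Longrightarrow> clique_of (\<lambda>u v. ecol u v = c) Q \<Longrightarrow> card Q \<noteq> 12"
  using no_clique_without_far_hub[of Q "\<not> c"] no_clique_with_far_hub[of Q "\<not> c"] by auto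

end

section \<open>The bound\<close>

definition leaf_797 :: "bool \<Rightarrow> nat \<Rightarrow> int option \<times> bool" where
  "leaf_797 s i = (Some (clique_797 s ! i), s)"

interpretation core_797: core_colouring P797.double_points P797.doubled "(None, True)" leaf_797
proof
  show "finite P797.double_points" by (rule P797.card_double_points)
  show "P797.doubled u v = P797.doubled v u" for u v by (rule P797.doubled_sym)
  show "card S \<noteq> 11"
    if "S \<subseteq> P797.double_points" "clique_of (\<lambda>u v. P797.doubled u v = s) S" for s S
    by (rule doubled_797_clique[OF that])
  show "(None, True) \<in> P797.double_points" by (simp add: P797.double_points_def)
  show "leaf_797 s i \<in> P797.double_points" if "i < 9" for s i
    using clique_797_range[OF that] by (simp add: leaf_797_def P797.double_points_def)
  show "leaf_797 s i \<noteq> (None, True)" for s i by (simp add: leaf_797_def)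
  show "P797.doubled (None, True) (leaf_797 s i) = s" for s i
    by (simp add: leaf_797_def P797.doubled_def P797.extended_def)
  show "leaf_797 s i \<noteq> leaf_797 s j" and "P797.doubled (leaf_797 s i) (leaf_797 s j) = s"
    if "i < 9" "j < 9" "i \<noteq> j" for s i j
  proof -
    have "distinct (clique_797 s)" "length (clique_797 s) = 9"
      by (cases s; simp add: clique_797_def)+
    then have "clique_797 s ! i \<noteq> clique_797 s ! j" using that by (simp add: nth_eq_iff_index_eq)
    then show "leaf_797 s i \<noteq> leaf_797 s j" "P797.doubled (leaf_797 s i) (leaf_797 s j) = s"
      using clique_797[OF that, of s] by (simp_all add: leaf_797_def P797.doubled_def P797.extended_def)
  qed
qed

theorem corollary5p1:
  shows "ramsey_number 12 12 \<ge> 1641"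
proof -
  have "card core_797.ext_points < ramsey_number 12 12"
  proof (rule ramsey_number_greaterI[where col = core_797.ecol])
    show "finite core_797.ext_points" by (rule core_797.finite_ext_points)
    show "core_797.ecol u v = core_797.ecol v u" for u v by (rule core_797.ecol_sym)
  qed (rule core_797.no_clique_ext_points; assumption)+
  moreover have "card core_797.ext_points = 1640"
    by (simp add: core_797.card_ext_points P797.card_double_points)
  ultimately show ?thesis by simp
qed

end
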